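(* Let $\mathfrak{g}$, $\mathfrak{h}$ be finite-dimensional complex Lie algebras such that there exists a crossed module $\mu:\mathfrak{h}\to\mathfrak{g}$ with $\mu([\mathfrak{h},\mathfrak{h}])\neq 0$. Then $$H^2(\mathfrak{h}\rtimes\mathfrak{g},\mathfrak{h}\rtimes\mathfrak{g})\neq 0,$$ where the semi-direct product is built from the action of $\mathfrak{g}$ on $\mathfrak{h}$ given by the crossed module $\mu$.
   Context: A crossed module of Lie algebras is a Lie algebra homomorphism $\mu:\mathfrak{h}\to\mathfrak{g}$ together with an action of $\mathfrak{g}$ on $\mathfrak{h}$ by derivations, written $g\cdot h$, such that for all $g\in\mathfrak{g}$ and $h,h'\in\mathfrak{h}$: (a) $\mu(g\cdot h)=[g,\mu(h)]$, and (b) $\mu(h)\cdot h'=[h,h']$. The semi-direct product $\mathfrak{h}\rtimes\mathfrak{g}$ is the vector space $\mathfrak{h}\oplus\mathfrak{g}$ with bracket $[(h,g),(h',g')]=(g\cdot h'-g'\cdot h,[g,g'])$; here $\mathfrak{h}$ is viewed as a $\mathfrak{g}$-module and as an abelian Lie algebra. $H^2(\mathfrak{l},\mathfrak{l})$ is the second Chevalley-Eilenberg cohomology space of $\mathfrak{l}$ with adjoint coefficients. *)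

theory Defs
  imports
    Complex_Main
    "HOL-Library.Function_Algebras"
    "HOL-Library.Set_Algebras"
    "HOL-Analysis.Product_Vector"
begin

section \<open>Lie algebras, modules and crossed modules\<close>

locale lie_algebra = vector_space scale
  for scale :: "'k::field \<Rightarrow> 'a::ab_group_add \<Rightarrow> 'a" +
  fixes bracket :: "'a \<Rightarrow> 'a \<Rightarrow> 'a"
  assumes bracket_linear_right: "Vector_Spaces.linear scale scale (\<lambda>y. bracket x y)"
    and bracket_linear_left: "Vector_Spaces.linear scale scale (\<lambda>x. bracket x y)"
    and bracket_self: "bracket x x = 0"
    and jacobi: "bracket x (bracket y z) + bracket y (bracket z x) + bracket z (bracket x y) = 0"

locale finite_dimensional_lie_algebra = lie_algebra scale bracket
  for scale :: "'k::field \<Rightarrow> 'a::ab_group_add \<Rightarrow> 'a" and bracket +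
  assumes finite_dimensional: "\<exists>Basis. finite_dimensional_vector_space scale Basis"

definition derived_algebra ::
    "('k::field \<Rightarrow> 'a::ab_group_add \<Rightarrow> 'a) \<Rightarrow> ('a \<Rightarrow> 'a \<Rightarrow> 'a) \<Rightarrow> 'a set" where
  "derived_algebra s br = module.span s {br x y | x y. True}"

locale lie_homomorphism =
  L1: lie_algebra s1 br1 + L2: lie_algebra s2 br2
  for s1 :: "'k::field \<Rightarrow> 'a::ab_group_add \<Rightarrow> 'a" and br1
    and s2 :: "'k \<Rightarrow> 'b::ab_group_add \<Rightarrow> 'b" and br2 +
  fixes f :: "'a \<Rightarrow> 'b"
  assumes hom_linear: "Vector_Spaces.linear s1 s2 f"
    and hom_bracket: "f (br1 x y) = br2 (f x) (f y)"

locale lie_module =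
  L: lie_algebra sL br + M: vector_space sM
  for sL :: "'k::field \<Rightarrow> 'l::ab_group_add \<Rightarrow> 'l" and br
    and sM :: "'k \<Rightarrow> 'm::ab_group_add \<Rightarrow> 'm" +
  fixes act :: "'l \<Rightarrow> 'm \<Rightarrow> 'm"
  assumes act_linear_right: "Vector_Spaces.linear sM sM (\<lambda>v. act x v)"
    and act_linear_left: "Vector_Spaces.linear sL sM (\<lambda>x. act x v)"
    and act_bracket: "act (br x y) v = act x (act y v) - act y (act x v)"

locale lie_derivation_action =
  lie_module sg brg sh act + H: lie_algebra sh brh
  for sg :: "'k::field \<Rightarrow> 'g::ab_group_add \<Rightarrow> 'g" and brg
    and sh :: "'k \<Rightarrow> 'h::ab_group_add \<Rightarrow> 'h" and brh and act +
  assumes act_derivation: "act x (brh u v) = brh (act x u) v + brh u (act x v)"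

locale lie_crossed_module =
  lie_homomorphism sh brh sg brg \<mu> + lie_derivation_action sg brg sh brh act
  for sh :: "'k::field \<Rightarrow> 'h::ab_group_add \<Rightarrow> 'h" and brh
    and sg :: "'k \<Rightarrow> 'g::ab_group_add \<Rightarrow> 'g" and brg
    and \<mu> :: "'h \<Rightarrow> 'g" and act :: "'g \<Rightarrow> 'h \<Rightarrow> 'h" +
  assumes equivariance: "\<mu> (act x u) = brg x (\<mu> u)"
    and peiffer: "act (\<mu> u) v = brh u v"

section \<open>The semi-direct product with an abelian ideal\<close>

text \<open>The bracket of \<open>\<hh>\<close> itself does not enter: \<open>\<hh>\<close> is regarded as a mere module.\<close>

definition semidirect_scale ::
    "('k::field \<Rightarrow> 'h::ab_group_add \<Rightarrow> 'h) \<Rightarrow> ('k \<Rightarrow> 'g::ab_group_add \<Rightarrow> 'g)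
      \<Rightarrow> 'k \<Rightarrow> 'h \<times> 'g \<Rightarrow> 'h \<times> 'g" where
  "semidirect_scale sh sg = module_prod.scale sh sg"

definition semidirect_bracket ::
    "('g \<Rightarrow> 'h \<Rightarrow> 'h::ab_group_add) \<Rightarrow> ('g \<Rightarrow> 'g \<Rightarrow> 'g) \<Rightarrow> 'h \<times> 'g \<Rightarrow> 'h \<times> 'g \<Rightarrow> 'h \<times> 'g" where
  "semidirect_bracket act brg = (\<lambda>(h, g) (h', g'). (act g h' - act g' h, brg g g'))"

section \<open>Chevalley--Eilenberg cohomology\<close>

text \<open>An \<open>n\<close>-cochain is an alternating \<open>n\<close>-linear map, encoded as a function on argument lists
  of length \<open>n\<close> that is extended by \<open>0\<close> to lists of any other length, so that distinct functions
  are distinct cochains.\<close>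

definition ce_cochains ::
    "('k::field \<Rightarrow> 'l::ab_group_add \<Rightarrow> 'l) \<Rightarrow> ('k \<Rightarrow> 'm::ab_group_add \<Rightarrow> 'm)
      \<Rightarrow> nat \<Rightarrow> ('l list \<Rightarrow> 'm) set" where
  "ce_cochains sL sM n = {f.
     (\<forall>xs. length xs \<noteq> n \<longrightarrow> f xs = 0) \<and>
     (\<forall>xs i. length xs = n \<longrightarrow> i < n \<longrightarrow> Vector_Spaces.linear sL sM (\<lambda>x. f (xs[i := x]))) \<and>
     (\<forall>xs. length xs = n \<longrightarrow> \<not> distinct xs \<longrightarrow> f xs = 0)}"

definition delete_nth :: "nat \<Rightarrow> 'a list \<Rightarrow> 'a list" where
  "delete_nth i xs = take i xs @ drop (Suc i) xs"

text \<open>With \<open>0\<close>-based indices,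
  \[(df)(x_0,\dots,x_n) = \sum_{i} (-1)^i\, x_i\cdot f(\dots,\widehat{x_i},\dots)
    + \sum_{i<j} (-1)^{i+j} f([x_i,x_j],\dots,\widehat{x_i},\dots,\widehat{x_j},\dots).\]\<close>

definition ce_differential ::
    "('l \<Rightarrow> 'l \<Rightarrow> 'l) \<Rightarrow> ('k::field \<Rightarrow> 'm::ab_group_add \<Rightarrow> 'm) \<Rightarrow> ('l \<Rightarrow> 'm \<Rightarrow> 'm)
      \<Rightarrow> nat \<Rightarrow> ('l list \<Rightarrow> 'm) \<Rightarrow> 'l list \<Rightarrow> 'm" where
  "ce_differential br sM act n f = (\<lambda>xs. if length xs = Suc n then
       (\<Sum>i<Suc n. sM ((-1) ^ i) (act (xs ! i) (f (delete_nth i xs))))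
     + (\<Sum>j<Suc n. \<Sum>i<j. sM ((-1) ^ (i + j))
          (f (br (xs ! i) (xs ! j) # delete_nth i (delete_nth j xs))))
     else 0)"

definition ce_cocycles ::
    "('k::field \<Rightarrow> 'l::ab_group_add \<Rightarrow> 'l) \<Rightarrow> ('l \<Rightarrow> 'l \<Rightarrow> 'l)
      \<Rightarrow> ('k \<Rightarrow> 'm::ab_group_add \<Rightarrow> 'm) \<Rightarrow> ('l \<Rightarrow> 'm \<Rightarrow> 'm) \<Rightarrow> nat \<Rightarrow> ('l list \<Rightarrow> 'm) set" where
  "ce_cocycles sL br sM act n = {f \<in> ce_cochains sL sM n. ce_differential br sM act n f = 0}"

definition ce_coboundaries ::
    "('k::field \<Rightarrow> 'l::ab_group_add \<Rightarrow> 'l) \<Rightarrow> ('l \<Rightarrow> 'l \<Rightarrow> 'l)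
      \<Rightarrow> ('k \<Rightarrow> 'm::ab_group_add \<Rightarrow> 'm) \<Rightarrow> ('l \<Rightarrow> 'm \<Rightarrow> 'm) \<Rightarrow> nat \<Rightarrow> ('l list \<Rightarrow> 'm) set" where
  "ce_coboundaries sL br sM act n =
     (case n of 0 \<Rightarrow> {0} | Suc m \<Rightarrow> ce_differential br sM act m ` ce_cochains sL sM m)"

text \<open>The quotient of cocycles by coboundaries, as a set of cosets; its zero vector is the coset
  \<open>ce_zero\<close> of the zero cocycle.\<close>

definition ce_cohomology ::
    "('k::field \<Rightarrow> 'l::ab_group_add \<Rightarrow> 'l) \<Rightarrow> ('l \<Rightarrow> 'l \<Rightarrow> 'l)
      \<Rightarrow> ('k \<Rightarrow> 'm::ab_group_add \<Rightarrow> 'm) \<Rightarrow> ('l \<Rightarrow> 'm \<Rightarrow> 'm) \<Rightarrow> nat \<Rightarrow> ('l list \<Rightarrow> 'm) set set" where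
  "ce_cohomology sL br sM act n =
     (\<lambda>f. f +o ce_coboundaries sL br sM act n) ` ce_cocycles sL br sM act n"

definition ce_zero ::
    "('k::field \<Rightarrow> 'l::ab_group_add \<Rightarrow> 'l) \<Rightarrow> ('l \<Rightarrow> 'l \<Rightarrow> 'l)
      \<Rightarrow> ('k \<Rightarrow> 'm::ab_group_add \<Rightarrow> 'm) \<Rightarrow> ('l \<Rightarrow> 'm \<Rightarrow> 'm) \<Rightarrow> nat \<Rightarrow> ('l list \<Rightarrow> 'm) set" where
  "ce_zero sL br sM act n = 0 +o ce_coboundaries sL br sM act n"

abbreviation adjoint_cohomology ::
    "('k::field \<Rightarrow> 'l::ab_group_add \<Rightarrow> 'l) \<Rightarrow> ('l \<Rightarrow> 'l \<Rightarrow> 'l) \<Rightarrow> nat \<Rightarrow> ('l list \<Rightarrow> 'l) set set" where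
  "adjoint_cohomology s br \<equiv> ce_cohomology s br s br"

abbreviation adjoint_zero ::
    "('k::field \<Rightarrow> 'l::ab_group_add \<Rightarrow> 'l) \<Rightarrow> ('l \<Rightarrow> 'l \<Rightarrow> 'l) \<Rightarrow> nat \<Rightarrow> ('l list \<Rightarrow> 'l) set" where
  "adjoint_zero s br \<equiv> ce_zero s br s br"

section \<open>Well-definedness\<close>

lemma (in lie_algebra) bracket_simps:
  "bracket (x + y) z = bracket x z + bracket y z" "bracket x (y + z) = bracket x y + bracket x z"
  "bracket (x - y) z = bracket x z - bracket y z" "bracket x (y - z) = bracket x y - bracket x z"
  "bracket (- x) z = - bracket x z" "bracket x (- z) = - bracket x z"
  "bracket 0 z = 0" "bracket x 0 = 0"
  "bracket (scale c x) z = scale c (bracket x z)" "bracket x (scale c z) = scale c (bracket x z)"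
proof -
  interpret r: module_hom scale scale "\<lambda>y. bracket u y" for u
    using bracket_linear_right by (simp add: module_hom_iff_linear)
  interpret l: module_hom scale scale "\<lambda>x. bracket x u" for u
    using bracket_linear_left by (simp add: module_hom_iff_linear)
  show "bracket (x + y) z = bracket x z + bracket y z" "bracket x (y + z) = bracket x y + bracket x z"
    "bracket (x - y) z = bracket x z - bracket y z" "bracket x (y - z) = bracket x y - bracket x z"
    "bracket (- x) z = - bracket x z" "bracket x (- z) = - bracket x z"
    "bracket 0 z = 0" "bracket x 0 = 0"
    "bracket (scale c x) z = scale c (bracket x z)" "bracket x (scale c z) = scale c (bracket x z)"
    by (rule l.add r.add l.diff r.diff l.neg r.neg l.zero r.zero l.scale r.scale)+
qed

lemma (in lie_algebra) bracket_skew: "bracket x y = - bracket y x"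
proof -
  have "0 = bracket (x + y) (x + y)" by (simp only: bracket_self)
  also have "\<dots> = bracket x y + bracket y x" by (simp only: bracket_simps) (simp add: bracket_self)
  finally show ?thesis by (simp add: eq_neg_iff_add_eq_0)
qed

lemma (in lie_module) act_simps:
  "act (x + y) v = act x v + act y v" "act x (v + w) = act x v + act x w"
  "act (x - y) v = act x v - act y v" "act x (v - w) = act x v - act x w"
  "act (- x) v = - act x v" "act x (- v) = - act x v"
  "act 0 v = 0" "act x 0 = 0"
  "act (sL c x) v = sM c (act x v)" "act x (sM c v) = sM c (act x v)"
proof -
  interpret r: module_hom sM sM "\<lambda>v. act u v" for u
    using act_linear_right by (simp add: module_hom_iff_linear)
  interpret l: module_hom sL sM "\<lambda>x. act x v" for v
    using act_linear_left by (simp add: module_hom_iff_linear)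
  show "act (x + y) v = act x v + act y v" "act x (v + w) = act x v + act x w"
    "act (x - y) v = act x v - act y v" "act x (v - w) = act x v - act x w"
    "act (- x) v = - act x v" "act x (- v) = - act x v"
    "act 0 v = 0" "act x 0 = 0"
    "act (sL c x) v = sM c (act x v)" "act x (sM c v) = sM c (act x v)"
    by (rule l.add r.add l.diff r.diff l.neg r.neg l.zero r.zero l.scale r.scale)+
qed

lemma (in lie_algebra) adjoint_module: "lie_module scale bracket scale bracket"
proof (intro lie_module.intro lie_module_axioms.intro lie_algebra_axioms vector_space_axioms
    bracket_linear_right bracket_linear_left)
  fix x y z
  have "bracket (bracket x y) z = - bracket z (bracket x y)" by (rule bracket_skew)
  moreover have "bracket y (bracket z x) = - bracket y (bracket x z)"
    by (simp add: bracket_skew[of z x] bracket_simps)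
  ultimately show "bracket (bracket x y) z = bracket x (bracket y z) - bracket y (bracket x z)"
    using jacobi[of x y z]
    by (simp only: eq_neg_iff_add_eq_0) (metis add_diff_cancel_left' add_uminus_conv_diff diff_minus_eq_add
        eq_neg_iff_add_eq_0)
qed

lemma (in lie_module) semidirect_scale_apply:
  "semidirect_scale sM sL c (v, x) = (sM c v, sL c x)"
proof -
  interpret module_prod sM sL by unfold_locales
  show ?thesis by (simp add: semidirect_scale_def scale_prod)
qed

lemma (in lie_module) semidirect_lie_algebra:
  "lie_algebra (semidirect_scale sM sL) (semidirect_bracket act br)"
proof -
  let ?s = "semidirect_scale sM sL" and ?b = "semidirect_bracket act br"
  have vs: "vector_space ?s"
    by unfold_locales
      (auto simp: semidirect_scale_apply M.scale_right_distrib M.scale_left_distrib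
        L.scale_right_distrib L.scale_left_distrib)
  have lin: "Vector_Spaces.linear ?s ?s f"
    if "\<And>x y. f (x + y) = f x + f y" "\<And>c x. f (?s c x) = ?s c (f x)" for f
    using that vs by (simp add: module_hom_iff_linear[symmetric] module_hom_def
        module_hom_axioms_def module_iff_vector_space)
  show ?thesis
  proof (intro lie_algebra.intro vs lie_algebra_axioms.intro lin)
    fix x y z :: "'m \<times> 'l" and c :: 'k
    obtain u a v b w d where xyz: "x = (u, a)" "y = (v, b)" "z = (w, d)"
      by (cases x, cases y, cases z)
    note * = xyz semidirect_bracket_def semidirect_scale_apply act_simps L.bracket_simps
      L.bracket_self
    show "?b x (y + z) = ?b x y + ?b x z" "?b (x + y) z = ?b x z + ?b y z" "?b x x = 0"
      by (simp_all add: * zero_prod_def)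
    show "?b x (?s c y) = ?s c (?b x y)" "?b (?s c x) y = ?s c (?b x y)"
      by (simp_all add: * M.scale_right_diff_distrib)
    show "?b x (?b y z) + ?b y (?b z x) + ?b z (?b x y) = 0"
      using L.jacobi[of a b d] by (simp add: * act_bracket zero_prod_def algebra_simps)
  qed
qed

end

theory Submission
  imports Defs
begin

text \<open>
  Grade \<open>\<hh> \<rtimes> \<gg>\<close> by giving \<open>\<hh>\<close> degree 1 and \<open>\<gg>\<close> degree 0. The bracket respects this grading
  because \<open>\<hh>\<close> is an abelian ideal, so the Chevalley--Eilenberg differential preserves the weight
  of adjoint cochains. A linear endomorphism has components of weight \<open>-1\<close>, \<open>0\<close> and \<open>1\<close> only,
  whereas a 2-cochain \<open>\<hh> \<times> \<hh> \<rightarrow> \<gg>\<close> has weight \<open>-2\<close>. Hence a non-zero cocycle of this shape is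
  never a coboundary (\<open>snd_coboundary_ideal_eq_0\<close> is the concrete form of this remark).

  A crossed module supplies such a cocycle, namely
  (as \<open>crossed_cochain\<close>)
  \[\omega((h,g),(h',g')) = (0, \mu([h,h'])).\]
  In \<open>d\<omega>\<close> the \<open>\<hh>\<close>-component is a cyclic sum of terms \<open>\<mu>([h,h']) \<cdot> h'' = [[h,h'],h'']\<close>, which is
  the Jacobi identity of \<open>\<hh>\<close>; the \<open>\<gg>\<close>-component vanishes because \<open>\<mu>\<close> is equivariant and \<open>\<gg>\<close> acts
  by derivations (\<open>crossed_cochain_cocycle\<close>). The condition \<open>\<mu>([\<hh>,\<hh>]) \<noteq> 0\<close> says exactly
  \<open>\<omega> \<noteq> 0\<close>.
\<close>

context lie_module
begin

lemma ce_differential_1: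
  "ce_differential br sM act 1 f [x, y] = act x (f [y]) - act y (f [x]) - f [br x y]"
  by (simp add: ce_differential_def delete_nth_def)

lemma ce_differential_2:
  "ce_differential br sM act 2 f [x, y, z] =
     act x (f [y, z]) - act y (f [x, z]) + act z (f [x, y])
     - f [br x y, z] + f [br x z, y] - f [br y z, x]"
  by (simp add: ce_differential_def delete_nth_def numeral_2_eq_2 numeral_3_eq_3)

lemma zero_in_ce_coboundaries: "0 \<in> ce_coboundaries sL br sM act n"
proof (cases n)
  case (Suc m)
  have "Vector_Spaces.linear sL sM (\<lambda>_. 0)"
    by (simp add: module_hom_iff_linear[symmetric] module_hom_def module_hom_axioms_def
        L.module_axioms M.module_axioms)
  then have "0 \<in> ce_cochains sL sM m"
    by (simp add: ce_cochains_def)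
  moreover have "ce_differential br sM act m 0 = 0"
    by (auto simp: ce_differential_def act_simps fun_eq_iff)
  ultimately show ?thesis
    using Suc by (auto simp: ce_coboundaries_def image_iff intro!: bexI[of _ 0])
qed (simp add: ce_coboundaries_def)

text \<open>The coset of \<open>f\<close> contains \<open>f\<close> itself, because the zero cochain is a coboundary.\<close>

lemma ce_cohomology_nonzeroI:
  assumes "f \<in> ce_cocycles sL br sM act n" and "f \<notin> ce_coboundaries sL br sM act n"
  shows "ce_cohomology sL br sM act n \<noteq> {ce_zero sL br sM act n}"
proof
  assume "ce_cohomology sL br sM act n = {ce_zero sL br sM act n}"
  then have "f +o ce_coboundaries sL br sM act n = ce_coboundaries sL br sM act n"
    using assms(1) by (auto simp: ce_cohomology_def ce_zero_def)
  then have "f + 0 \<in> ce_coboundaries sL br sM act n"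
    using zero_in_ce_coboundaries by (metis set_plus_intro2)
  with assms(2) show False by simp
qed

text \<open>Let \<open>f = d\<phi>\<close>. In the second component, \<open>[(u,0), \<phi>(v,0)]\<close> and \<open>[(v,0), \<phi>(u,0)]\<close> contribute
  nothing since the module is an ideal of the semi-direct product, and \<open>\<phi>[(u,0),(v,0)]\<close> vanishes since the ideal is abelian.\<close>

lemma snd_coboundary_ideal_eq_0:
  assumes "f \<in> ce_coboundaries (semidirect_scale sM sL) (semidirect_bracket act br)
             (semidirect_scale sM sL) (semidirect_bracket act br) 2"
  shows "snd (f [(u, 0), (v, 0)]) = 0"
proof -
  let ?s = "semidirect_scale sM sL" and ?b = "semidirect_bracket act br"
  interpret S: lie_algebra ?s ?b by (rule semidirect_lie_algebra)
  interpret A: lie_module ?s ?b ?s ?b by (rule S.adjoint_module)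
  from assms obtain \<phi> where \<phi>: "\<phi> \<in> ce_cochains ?s ?s 1" and f: "f = ce_differential ?b ?s ?b 1 \<phi>"
    by (auto simp: ce_coboundaries_def numeral_2_eq_2)
  from \<phi> have "\<forall>xs i. length xs = 1 \<longrightarrow> i < 1 \<longrightarrow>
      Vector_Spaces.linear ?s ?s (\<lambda>x. \<phi> (xs[i := x]))"
    unfolding ce_cochains_def mem_Collect_eq by (elim conjE)
  from this[rule_format, of "[0]" 0] have "module_hom ?s ?s (\<lambda>x. \<phi> [x])"
    by (simp add: module_hom_iff_linear)
  from module_hom.zero[OF this] have "\<phi> [0] = 0"
    by simp
  moreover have "?b (u, 0) (v, 0) = 0"
    by (simp add: semidirect_bracket_def act_simps L.bracket_simps zero_prod_def)
  moreover have "snd (?b (w, 0) p) = 0" for w p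
    by (cases p) (simp add: semidirect_bracket_def L.bracket_simps)
  ultimately show ?thesis
    unfolding f A.ce_differential_1 by (simp only: snd_diff diff_self snd_zero)
qed

end

definition crossed_cochain ::
    "('h \<Rightarrow> 'h \<Rightarrow> 'h) \<Rightarrow> ('h \<Rightarrow> 'g) \<Rightarrow> ('h \<times> 'g) list \<Rightarrow> 'h::ab_group_add \<times> 'g::ab_group_add" where
  "crossed_cochain brh \<mu> xs =
     (if length xs = 2 then (0, \<mu> (brh (fst (xs ! 0)) (fst (xs ! 1)))) else 0)"

context lie_crossed_module
begin

lemma hom_simps:
  "\<mu> (x + y) = \<mu> x + \<mu> y" "\<mu> (x - y) = \<mu> x - \<mu> y" "\<mu> 0 = 0" "\<mu> (sh c x) = sg c (\<mu> x)"
proof -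
  interpret m: module_hom sh sg \<mu>
    using hom_linear by (simp add: module_hom_iff_linear)
  show "\<mu> (x + y) = \<mu> x + \<mu> y" "\<mu> (x - y) = \<mu> x - \<mu> y" "\<mu> 0 = 0" "\<mu> (sh c x) = sg c (\<mu> x)"
    by (rule m.add m.diff m.zero m.scale)+
qed

lemma crossed_cochain_cochain:
  "crossed_cochain brh \<mu> \<in> ce_cochains (semidirect_scale sh sg) (semidirect_scale sh sg) 2"
proof -
  let ?s = "semidirect_scale sh sg"
  interpret S: lie_algebra ?s "semidirect_bracket act brg" by (rule semidirect_lie_algebra)
  have "Vector_Spaces.linear ?s ?s (\<lambda>x. crossed_cochain brh \<mu> (xs[i := x]))"
    if "length xs = 2" "i < 2" for xs :: "('h \<times> 'g) list" and i
  proof -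
    have "i = 0 \<or> i = 1" using that by auto
    with that show ?thesis
      by (auto simp: module_hom_iff_linear[symmetric] module_hom_def module_hom_axioms_def
          S.module_axioms crossed_cochain_def semidirect_scale_apply L1.bracket_simps hom_simps)
  qed
  moreover have "crossed_cochain brh \<mu> xs = 0"
    if "length xs = 2" "\<not> distinct xs" for xs :: "('h \<times> 'g) list"
  proof -
    have "xs ! 0 = xs ! 1"
      using that by (auto simp: numeral_2_eq_2 length_Suc_conv)
    then show ?thesis
      by (simp add: crossed_cochain_def L1.bracket_self hom_simps zero_prod_def)
  qed
  ultimately show ?thesis
    by (auto simp: ce_cochains_def crossed_cochain_def)
qed

text \<open>The Peiffer identity turns the \<open>\<hh>\<close>-component of \<open>d\<omega>\<close> into the Jacobi identity of \<open>\<hh>\<close>;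
  in the \<open>\<gg>\<close>-component \<open>[g, \<mu>([h,h'])] = \<mu>([g \<cdot> h, h']) + \<mu>([h, g \<cdot> h'])\<close> cancels the terms of
  \<open>\<omega>([x,y],z)\<close>.\<close>

lemma crossed_cochain_cocycle:
  "crossed_cochain brh \<mu> \<in> ce_cocycles (semidirect_scale sh sg) (semidirect_bracket act brg)
     (semidirect_scale sh sg) (semidirect_bracket act brg) 2"
proof -
  let ?s = "semidirect_scale sh sg" and ?b = "semidirect_bracket act brg"
    and ?\<omega> = "crossed_cochain brh \<mu>"
  interpret S: lie_algebra ?s ?b by (rule semidirect_lie_algebra)
  interpret A: lie_module ?s ?b ?s ?b by (rule S.adjoint_module)
  have closed: "ce_differential ?b ?s ?b 2 ?\<omega> [(u, a), (v, b), (w, c)] = 0" for u a v b w c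
  proof -
    have "brh (brh v w) u = - brh u (brh v w)" "brh (brh u w) v = brh v (brh w u)"
      "brh (brh u v) w = - brh w (brh u v)"
      by (rule L1.bracket_skew, simp add: L1.bracket_skew[of u w] L1.bracket_skew[of _ v] L1.bracket_simps,
          rule L1.bracket_skew)
    then have fst_eq: "- brh (brh v w) u + brh (brh u w) v - brh (brh u v) w = 0"
      using L1.jacobi[of u v w] by (simp add: algebra_simps)
    have g: "brg x (\<mu> (brh p q)) = \<mu> (brh (act x p) q) - \<mu> (brh (act x q) p)" for x p q
      by (simp add: equivariance[symmetric] act_derivation L1.bracket_skew[of p "act x q"]
          flip: hom_simps(2))
    show ?thesis
      using fst_eq unfolding A.ce_differential_2
      by (simp add: crossed_cochain_def semidirect_bracket_def act_simps peiffer g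
          L1.bracket_simps hom_simps zero_prod_def)
  qed
  have "ce_differential ?b ?s ?b 2 ?\<omega> xs = 0" for xs
  proof (cases "length xs = 3")
    case True
    then obtain x y z where "xs = [x, y, z]"
      by (auto simp: numeral_3_eq_3 length_Suc_conv)
    then show ?thesis
      by (cases x, cases y, cases z) (simp add: closed)
  qed (simp add: ce_differential_def)
  then show ?thesis
    by (auto simp: ce_cocycles_def crossed_cochain_cochain fun_eq_iff)
qed

lemma hom_derived_algebra_nonzeroE:
  assumes "\<mu> ` derived_algebra sh brh \<noteq> {0}"
  obtains u v where "\<mu> (brh u v) \<noteq> 0"
proof (rule ccontr)
  assume "\<not> thesis"
  with that have z: "\<mu> (brh u v) = 0" for u v by blast
  have "\<mu> x = 0" if "x \<in> L1.span {brh u v | u v. True}" for x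
    using that by (induction rule: L1.span_induct_alt) (auto simp: z hom_simps)
  moreover have "0 \<in> L1.span {brh u v | u v. True}" by (rule L1.span_zero)
  ultimately have "\<mu> ` derived_algebra sh brh = {0}"
    unfolding derived_algebra_def using hom_simps(3) by force
  with assms show False by simp
qed

theorem semidirect_adjoint_cohomology_2_nonzero:
  assumes "\<mu> ` derived_algebra sh brh \<noteq> {0}"
  shows "adjoint_cohomology (semidirect_scale sh sg) (semidirect_bracket act brg) 2
           \<noteq> {adjoint_zero (semidirect_scale sh sg) (semidirect_bracket act brg) 2}"
proof -
  interpret S: lie_algebra "semidirect_scale sh sg" "semidirect_bracket act brg"
    by (rule semidirect_lie_algebra)
  obtain u v where "\<mu> (brh u v) \<noteq> 0"
    using assms by (rule hom_derived_algebra_nonzeroE)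
  then have "snd (crossed_cochain brh \<mu> [(u, 0), (v, 0)]) \<noteq> 0"
    by (simp add: crossed_cochain_def)
  then have "crossed_cochain brh \<mu> \<notin> ce_coboundaries (semidirect_scale sh sg)
      (semidirect_bracket act brg) (semidirect_scale sh sg) (semidirect_bracket act brg) 2"
    using snd_coboundary_ideal_eq_0 by blast
  with crossed_cochain_cocycle show ?thesis
    by (rule lie_module.ce_cohomology_nonzeroI[OF S.adjoint_module])
qed

end

theorem theorem3p3:
  fixes sg :: "complex \<Rightarrow> 'g::ab_group_add \<Rightarrow> 'g" and brg :: "'g \<Rightarrow> 'g \<Rightarrow> 'g"
    and sh :: "complex \<Rightarrow> 'h::ab_group_add \<Rightarrow> 'h" and brh :: "'h \<Rightarrow> 'h \<Rightarrow> 'h"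
    and \<mu> :: "'h \<Rightarrow> 'g" and act :: "'g \<Rightarrow> 'h \<Rightarrow> 'h"
  assumes "finite_dimensional_lie_algebra sg brg"
    and "finite_dimensional_lie_algebra sh brh"
    and "lie_crossed_module sh brh sg brg \<mu> act"
    and "\<mu> ` derived_algebra sh brh \<noteq> {0}"
  shows "adjoint_cohomology (semidirect_scale sh sg) (semidirect_bracket act brg) 2
           \<noteq> {adjoint_zero (semidirect_scale sh sg) (semidirect_bracket act brg) 2}"
  using assms(3,4) by (rule lie_crossed_module.semidirect_adjoint_cohomology_2_nonzero)

end
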